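(* Every connected $4$-regular graph of odd order has a rooted $2$-odd decomposition, i.e.\ a decomposition into two closed trails, each of odd length, that have a vertex in common.
   Context: Graphs are finite and may have multiple edges and loops (a loop contributes $2$ to the degree of its vertex). A graph is eulerian if it is connected and every vertex has even degree. A decomposition of a graph $G$ is a set $\{G_1,\dots,G_k\}$ of subgraphs of $G$ whose edge sets partition $E(G)$. A decomposition is $k$-odd if it has $k$ constituents, each of which is an eulerian subgraph (equivalently, a closed trail) with an odd number of edges. It is rooted if there is a vertex $v$ of $G$ (a root) contained in every constituent. *)

theory Defs
  imports "HOL-Library.Disjoint_Sets"
begin

text \<open>
  Undirected graphs, possibly with parallel edges and loops. Edges are abstract objects, and
  \<open>ends G e\<close> is the set of end vertices of \<open>e\<close>, so \<open>e\<close> is a loop iff this set is a singleton.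
  The value of \<open>ends G\<close> outside \<open>edges G\<close> is irrelevant.
\<close>

record ('v, 'e) mgraph =
  verts :: "'v set"
  edges :: "'e set"
  ends :: "'e \<Rightarrow> 'v set"

definition multigraph :: "('v, 'e) mgraph \<Rightarrow> bool" where
  "multigraph G \<longleftrightarrow> finite (verts G) \<and> finite (edges G) \<and>
     (\<forall>e\<in>edges G. ends G e \<subseteq> verts G \<and> card (ends G e) \<in> {1, 2})"

text \<open>The second summand makes every loop count twice.\<close>

definition vertex_degree :: "('v, 'e) mgraph \<Rightarrow> 'v \<Rightarrow> nat" where
  "vertex_degree G v = card {e \<in> edges G. v \<in> ends G e} + card {e \<in> edges G. ends G e = {v}}"

definition regular_graph :: "nat \<Rightarrow> ('v, 'e) mgraph \<Rightarrow> bool" where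
  "regular_graph d G \<longleftrightarrow> (\<forall>v\<in>verts G. vertex_degree G v = d)"

definition adjacency :: "('v, 'e) mgraph \<Rightarrow> 'v rel" where
  "adjacency G = {(u, v). \<exists>e\<in>edges G. ends G e = {u, v}}"

definition connected_graph :: "('v, 'e) mgraph \<Rightarrow> bool" where
  "connected_graph G \<longleftrightarrow> verts G \<noteq> {} \<and> (\<forall>u\<in>verts G. \<forall>v\<in>verts G. (u, v) \<in> (adjacency G)\<^sup>*)"

definition eulerian :: "('v, 'e) mgraph \<Rightarrow> bool" where
  "eulerian G \<longleftrightarrow> connected_graph G \<and> (\<forall>v\<in>verts G. even (vertex_degree G v))"

definition subgraph :: "('v, 'e) mgraph \<Rightarrow> ('v, 'e) mgraph \<Rightarrow> bool" where
  "subgraph H G \<longleftrightarrow> multigraph H \<and> verts H \<subseteq> verts G \<and> edges H \<subseteq> edges G \<and>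
     (\<forall>e\<in>edges H. ends H e = ends G e)"

text \<open>
  Injectivity is needed because \<open>edges ` D\<close> alone would identify distinct constituents
  having the same edges.
\<close>

definition decomposition :: "('v, 'e) mgraph \<Rightarrow> ('v, 'e) mgraph set \<Rightarrow> bool" where
  "decomposition G D \<longleftrightarrow> finite D \<and> (\<forall>H\<in>D. subgraph H G) \<and>
     inj_on edges D \<and> partition_on (edges G) (edges ` D)"

definition odd_decomposition :: "nat \<Rightarrow> ('v, 'e) mgraph \<Rightarrow> ('v, 'e) mgraph set \<Rightarrow> bool" where
  "odd_decomposition k G D \<longleftrightarrow> decomposition G D \<and> card D = k \<and>
     (\<forall>H\<in>D. eulerian H \<and> odd (card (edges H)))"

definition rooted :: "('v, 'e) mgraph \<Rightarrow> ('v, 'e) mgraph set \<Rightarrow> bool" where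
  "rooted G D \<longleftrightarrow> (\<exists>v\<in>verts G. \<forall>H\<in>D. v \<in> verts H)"

end

theory Submission
  imports Defs
begin

text \<open>
  An Euler tour of a connected 4-regular graph of order \<open>n\<close> has \<open>2n\<close> positions and visits every
  vertex exactly twice. If the two visits always happened at positions of equal parity, the \<open>n\<close>
  even positions would be grouped in pairs, so \<open>n\<close> would be even. Hence, for odd \<open>n\<close>, some
  vertex is visited at positions of different parity, and cutting the tour there yields two closed
  trails of odd length through this vertex.
\<close>

section \<open>Walks\<close>

text \<open>
  A walk is the list of its steps, each given by its tail and its edge. Recording the tails is
  necessary because the edges alone do not determine the visited vertices.
\<close>

fun walk :: "('e \<Rightarrow> 'v set) \<Rightarrow> 'v \<Rightarrow> ('v \<times> 'e) list \<Rightarrow> 'v \<Rightarrow> bool" where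
  "walk g u [] w \<longleftrightarrow> u = w"
| "walk g u ((x, e) # ps) w \<longleftrightarrow> x = u \<and> (\<exists>y. g e = {x, y} \<and> walk g y ps w)"

lemma walk_append:
  "walk g u (ps @ qs) w \<longleftrightarrow> (\<exists>x. walk g u ps x \<and> walk g x qs w)"
  by (induction g u ps w arbitrary: rule: walk.induct) auto

lemma walk_tail:
  assumes "walk g u ps w" "ps \<noteq> []"
  shows "fst (hd ps) = u"
  using assms by (cases ps) auto

lemma walk_rotate:
  assumes "walk g u (ps @ qs) u" "qs \<noteq> []"
  shows "walk g (fst (hd qs)) (qs @ ps) (fst (hd qs))"
  using assms walk_tail unfolding walk_append by metis

text \<open>The head of a step is the tail of the next one, or the final vertex
  \<open>w\<close>.\<close>

lemma walk_ends_subset: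
  assumes "walk g u ps w" "e \<in> snd ` set ps"
  shows "g e \<subseteq> insert w (fst ` set ps)"
  using assms
proof (induction g u ps w rule: walk.induct)
  case (2 g u x e' ps w)
  then obtain y where y: "g e' = {x, y}" "walk g y ps w" by auto
  have "y \<in> insert w (fst ` set ps)"
    using walk_tail[OF y(2)] y(2) by (cases ps) auto
  then show ?case using 2 y by auto
qed simp

lemma walk_tails_subset:
  assumes "walk g u ps w"
  shows "fst ` set ps \<subseteq> \<Union> (g ` snd ` set ps)"
  using assms by (induction g u ps w rule: walk.induct) auto

lemma adjacency_sym: "sym (adjacency G)"
  by (auto simp: adjacency_def sym_def insert_commute)

lemma walk_reachable:
  assumes "walk (ends G) u ps w" "snd ` set ps \<subseteq> edges G" "x \<in> fst ` set ps"
  shows "(u, x) \<in> (adjacency G)\<^sup>*"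
  using assms
proof (induction ps arbitrary: u)
  case (Cons p ps)
  obtain a e where p: "p = (a, e)" by force
  with Cons.prems obtain y where y: "ends G e = {u, y}" "walk (ends G) y ps w" "a = u" by auto
  have "(u, y) \<in> adjacency G"
    using y Cons.prems p by (auto simp: adjacency_def)
  moreover have "x = u \<or> (y, x) \<in> (adjacency G)\<^sup>*"
    using Cons.IH[OF y(2)] Cons.prems p y by auto
  ultimately show ?case by (auto intro: converse_rtrancl_into_rtrancl)
qed simp

section \<open>Degrees along trails\<close>

text \<open>The contribution to the degree of \<open>v\<close> of an edge with end set
  \<open>A\<close>; it turns degrees into sums that can be taken along a walk.\<close>

definition incidence :: "'v set \<Rightarrow> 'v \<Rightarrow> nat" where
  "incidence A v = of_bool (v \<in> A) + of_bool (A = {v})"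

lemma incidence_insert: "incidence {x, y} v = of_bool (x = v) + of_bool (y = v)"
  by (auto simp: incidence_def)

lemma vertex_degree_eq_sum:
  assumes "finite (edges G)"
  shows "vertex_degree G v = (\<Sum>e\<in>edges G. incidence (ends G e) v)"
  using assms by (simp add: vertex_degree_def incidence_def sum.distrib Int_def)

text \<open>A step contributes one at its tail and one at its head, and its head is the tail of the
  next step. So each tail counts twice, up to a correction: nothing enters the first tail, and the
  last head \<open>w\<close> is not followed by a step. Adding both corrections avoids
  subtraction.\<close>

lemma walk_degree:
  assumes "walk g u ps w"
  shows "(\<Sum>e\<leftarrow>map snd ps. incidence (g e) v) + of_bool (u = v)
    = 2 * count_list (map fst ps) v + of_bool (w = v)"
  using assms
proof (induction ps arbitrary: u)
  case (Cons p ps)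
  obtain a e where p: "p = (a, e)" by force
  with Cons.prems obtain y where y: "g e = {u, y}" "walk g y ps w" "a = u" by auto
  show ?case using Cons.IH[OF y(2)] y p by (auto simp: incidence_insert)
qed simp

lemma trail_degree:
  assumes "walk g u ps w" "distinct (map snd ps)"
  shows "(\<Sum>e\<in>snd ` set ps. incidence (g e) v) + of_bool (u = v)
    = 2 * count_list (map fst ps) v + of_bool (w = v)"
  using walk_degree[OF assms(1), of v]
    sum_list_distinct_conv_sum_set[OF assms(2), of "\<lambda>e. incidence (g e) v"]
  by (simp only: set_map)

text \<open>Taking the tails as vertices suffices for a nonempty closed walk, whose final vertex is
  its first tail.\<close>

definition graph_of_walk :: "('e \<Rightarrow> 'v set) \<Rightarrow> ('v \<times> 'e) list \<Rightarrow> ('v, 'e) mgraph" where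
  "graph_of_walk g ps = \<lparr>verts = fst ` set ps, edges = snd ` set ps, ends = g\<rparr>"

lemma graph_of_walk_simps [simp]:
  "verts (graph_of_walk g ps) = fst ` set ps"
  "edges (graph_of_walk g ps) = snd ` set ps"
  "ends (graph_of_walk g ps) = g"
  by (simp_all add: graph_of_walk_def)

lemma walk_card_ends:
  assumes "walk g u ps w" "e \<in> snd ` set ps"
  shows "card (g e) \<in> {1, 2}"
  using assms by (induction g u ps w rule: walk.induct) (auto simp: card_insert_if split: if_splits)

lemma closed_trail_eulerian:
  assumes w: "walk g u ps u" and d: "distinct (map snd ps)" and ne: "ps \<noteq> []"
  shows "eulerian (graph_of_walk g ps)"
proof -
  let ?H = "graph_of_walk g ps"
  have reach: "(u, x) \<in> (adjacency ?H)\<^sup>*" if "x \<in> verts ?H" for x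
    using walk_reachable[of ?H u ps u x] w that by simp
  then have "(x, y) \<in> (adjacency ?H)\<^sup>*" if "x \<in> verts ?H" "y \<in> verts ?H" for x y
    using that adjacency_sym sym_rtrancl by (metis rtrancl_trans symD)
  moreover have "even (vertex_degree ?H v)" for v
    using trail_degree[OF w d, of v] by (simp add: vertex_degree_eq_sum)
  ultimately show ?thesis
    using ne by (auto simp: eulerian_def connected_graph_def)
qed

lemma closed_trail_subgraph:
  assumes "multigraph G" and w: "walk (ends G) u ps u" and sub: "snd ` set ps \<subseteq> edges G"
  shows "subgraph (graph_of_walk (ends G) ps) G"
proof -
  have "ends G e \<subseteq> fst ` set ps" if "e \<in> snd ` set ps" for e
    using walk_ends_subset[OF w that] walk_tail[OF w] that by (cases ps) auto
  moreover have "fst ` set ps \<subseteq> verts G"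
    using walk_tails_subset[OF w] sub assms(1) unfolding multigraph_def by blast
  ultimately show ?thesis
    using walk_card_ends[OF w] sub by (auto simp: subgraph_def multigraph_def)
qed

section \<open>Euler tours\<close>

definition trail :: "('v, 'e) mgraph \<Rightarrow> 'v \<Rightarrow> ('v \<times> 'e) list \<Rightarrow> 'v \<Rightarrow> bool" where
  "trail G u ps w \<longleftrightarrow> u \<in> verts G \<and> walk (ends G) u ps w \<and>
     distinct (map snd ps) \<and> snd ` set ps \<subseteq> edges G"

lemma trail_length_le:
  assumes "finite (edges G)" "trail G u ps w"
  shows "length ps \<le> card (edges G)"
  using assms card_mono[of "edges G" "set (map snd ps)"] distinct_card[of "map snd ps"]
  by (simp add: trail_def)

lemma trail_extend:
  assumes "multigraph G" "trail G u ps w" "e \<in> edges G" "w \<in> ends G e" "e \<notin> snd ` set ps"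
  shows "\<exists>y. trail G u (ps @ [(w, e)]) y"
proof -
  have "card (ends G e) \<in> {1, 2}" using assms by (auto simp: multigraph_def)
  then obtain a b where "ends G e = {a, b}"
    by (fastforce simp: card_1_singleton_iff card_2_iff)
  \<comment> \<open>The new end of the trail is the other end of \<open>e\<close>, which is
    \<open>w\<close> again for a loop.\<close>
  then have "ends G e = {w, if w = a then b else a}"
    using assms(4) by auto
  then show ?thesis
    using assms by (auto simp: trail_def walk_append)
qed

text \<open>Serves to apply the maximality of a closed trail at each of its vertices, not just at
  its base point.\<close>

lemma trail_rotate:
  assumes "multigraph G" "trail G u ps u" "x \<in> fst ` set ps"
  shows "\<exists>qs. trail G x qs x \<and> set qs = set ps \<and> length qs = length ps"
proof -
  obtain e where "(x, e) \<in> set ps" using assms(3) by auto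
  then obtain as bs where ps: "ps = as @ (x, e) # bs" by (meson split_list)
  let ?qs = "(x, e) # bs @ as"
  have "walk (ends G) x ?qs x"
    using walk_rotate[of "ends G" u as "(x, e) # bs"] assms(2) ps by (simp add: trail_def)
  moreover have "x \<in> verts G"
    using calculation assms unfolding ps trail_def multigraph_def by fastforce
  ultimately show ?thesis
    using assms(2) unfolding ps trail_def by (intro exI[of _ ?qs]) auto
qed

lemma euler_tour_exists:
  assumes G: "multigraph G" and conn: "connected_graph G"
    and even: "\<forall>v\<in>verts G. even (vertex_degree G v)"
  shows "\<exists>u ps. trail G u ps u \<and> snd ` set ps = edges G"
proof -
  have fin: "finite (edges G)" using G by (simp add: multigraph_def)
  obtain u0 where "u0 \<in> verts G" using conn by (auto simp: connected_graph_def)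
  then have "\<exists>ps. (\<exists>u w. trail G u ps w)"
    by (intro exI[of _ "[]"] exI[of _ u0]) (simp add: trail_def)
  then obtain ps where "\<exists>u w. trail G u ps w"
    and max: "\<And>qs. (\<exists>u w. trail G u qs w) \<Longrightarrow> length qs \<le> length ps"
    using ex_has_greatest_nat[of "\<lambda>ps. \<exists>u w. trail G u ps w" _ length "Suc (card (edges G))"]
      trail_length_le[OF fin] by (metis less_Suc_eq_le)
  then obtain u w where t: "trail G u ps w" by auto
  \<comment> \<open>Stated for every trail of maximal length, since it is applied to rotations of
    \<open>ps\<close> as well.\<close>
  have used: "e \<in> snd ` set qs"
    if "trail G a qs b" "length qs = length ps" "e \<in> edges G" "b \<in> ends G e" for a b qs e
    using trail_extend[OF G that(1,3,4)] max that(2) by fastforce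
  have "w = u"
  proof (rule ccontr)
    assume "w \<noteq> u"
    have "w \<in> verts G"
    proof -
      have "ps \<noteq> []" using t \<open>w \<noteq> u\<close> by (auto simp: trail_def)
      then obtain qs x e where "ps = qs @ [(x, e)]" by (metis rev_exhaust surj_pair)
      then have "e \<in> edges G" "w \<in> ends G e" using t by (auto simp: trail_def walk_append)
      then show ?thesis using G by (auto simp: multigraph_def)
    qed
    \<comment> \<open>No edge at \<open>w\<close> is left over, so the trail accounts for the full
      degree of \<open>w\<close>; an end differing from the start makes this odd.\<close>
    have "(\<Sum>e\<in>edges G. incidence (ends G e) w) = (\<Sum>e\<in>snd ` set ps. incidence (ends G e) w)"
      using used[OF t refl] t fin
      by (intro sum.mono_neutral_right) (auto simp: trail_def incidence_def)
    also have "odd \<dots>"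
      using trail_degree[of "ends G" u ps w w] t \<open>w \<noteq> u\<close> by (simp add: trail_def)
    finally show False
      using even \<open>w \<in> verts G\<close> by (simp add: vertex_degree_eq_sum[OF fin])
  qed
  \<comment> \<open>Inserting \<open>u\<close> covers the case of an empty trail.\<close>
  let ?V = "insert u (fst ` set ps)"
  have all_used: "e \<in> snd ` set ps" if x: "x \<in> ?V" and e: "e \<in> edges G" "x \<in> ends G e" for x e
  proof (cases "x = u")
    case True
    then show ?thesis using used[OF t refl] e \<open>w = u\<close> by simp
  next
    case False
    then obtain qs where "trail G x qs x" "set qs = set ps" "length qs = length ps"
      using trail_rotate[OF G] t x \<open>w = u\<close> by blast
    then show ?thesis using used e by metis
  qed
  have reached: "y \<in> ?V" if "(u, y) \<in> (adjacency G)\<^sup>*" for y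
    using that
  proof induction
    case (step y z)
    then obtain e where e: "e \<in> edges G" "ends G e = {y, z}" by (auto simp: adjacency_def)
    then have "e \<in> snd ` set ps" using all_used[OF step.IH] by simp
    then show ?case
      using walk_ends_subset[of "ends G" u ps u e] t e \<open>w = u\<close> by (auto simp: trail_def)
  qed simp
  have V: "verts G \<subseteq> ?V"
    using reached conn t by (auto simp: connected_graph_def trail_def)
  have "edges G \<subseteq> snd ` set ps"
  proof
    fix e assume e: "e \<in> edges G"
    then have "ends G e \<noteq> {}" "ends G e \<subseteq> verts G"
      using G by (force simp: multigraph_def)+
    then obtain x where "x \<in> ends G e" "x \<in> ?V" using V by blast
    then show "e \<in> snd ` set ps" using all_used e by blast
  qed
  then show ?thesis using t \<open>w = u\<close> by (auto simp: trail_def)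
qed

section \<open>Splitting the tour\<close>

lemma card_even_lessThan_double: "card {i. i < 2 * n \<and> even i} = (n :: nat)"
proof -
  have "{i. i < 2 * n \<and> even i} = (*) 2 ` {..<n}" by (auto elim!: evenE)
  then show ?thesis by (simp add: card_image inj_on_def)
qed

lemma equal_entries_odd_distance:
  assumes fin: "finite V" and odd: "odd (card V)" and sub: "set xs \<subseteq> V"
    and count: "\<And>v. v \<in> V \<Longrightarrow> count_list xs v = 2"
  shows "\<exists>i j. i < j \<and> j < length xs \<and> xs ! i = xs ! j \<and> odd (j - i)"
proof (rule ccontr)
  assume neg: "\<not> ?thesis"
  have same: "even i \<longleftrightarrow> even j" if "i < length xs" "j < length xs" "xs ! i = xs ! j" for i j
  proof (cases i j rule: linorder_cases)
    case less then show ?thesis using neg that by (metis even_diff_nat less_imp_le_nat not_less even_add)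
  next
    case greater then show ?thesis using neg that by (metis even_diff_nat less_imp_le_nat not_less even_add)
  qed simp
  have len: "length xs = 2 * card V"
    using sum_count_set[OF sub fin] count by simp
  \<comment> \<open>The even positions of \<open>v\<close>: none or both of its two positions, by
    \<open>same\<close>. These sets are disjoint and together make up all \<open>card V\<close> even
    positions.\<close>
  let ?E = "\<lambda>v. {i. i < length xs \<and> even i \<and> v = xs ! i}"
  have "even (card (?E v))" if "v \<in> V" for v
  proof (cases "?E v = {}")
    case False
    then obtain i where "i < length xs" "even i" "v = xs ! i" by auto
    then have "?E v = {i. i < length xs \<and> v = xs ! i}" using same by blast
    then have "card (?E v) = 2"
      using count[OF that] by (simp add: count_list_eq_length_filter length_filter_conv_card)
    then show ?thesis by simp
  next
    case True
    then show ?thesis by (simp only: card.empty even_zero)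
  qed
  then have "even (\<Sum>v\<in>V. card (?E v))" by (simp add: dvd_sum)
  also have "(\<Sum>v\<in>V. card (?E v)) = card (\<Union>v\<in>V. ?E v)"
    using fin by (intro card_UN_disjoint[symmetric]) auto
  also have "(\<Union>v\<in>V. ?E v) = {i. i < 2 * card V \<and> even i}"
    using sub len by (auto simp: subset_iff)
  finally show False using odd by (simp add: card_even_lessThan_double)
qed

theorem theorem1:
  fixes G :: "('v, 'e) mgraph"
  assumes "multigraph G" and "connected_graph G" and "regular_graph 4 G" and "odd (card (verts G))"
  shows "\<exists>D. odd_decomposition 2 G D \<and> rooted G D"
proof -
  have fin: "finite (verts G)" "finite (edges G)"
    using assms(1) by (auto simp: multigraph_def)
  obtain u ps where t: "trail G u ps u" and all: "snd ` set ps = edges G"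
    using euler_tour_exists[OF assms(1,2)] assms(3) by (auto simp: regular_graph_def)
  let ?xs = "map fst ps"
  have w: "walk (ends G) u ps u" and d: "distinct (map snd ps)"
    using t by (auto simp: trail_def)
  \<comment> \<open>The end corrections cancel on a closed trail, so degree 4 is twice the number of
    visits.\<close>
  have count: "count_list ?xs v = 2" if "v \<in> verts G" for v
    using trail_degree[OF w d, of v] vertex_degree_eq_sum[OF fin(2), of v] all assms(3) that
    by (simp add: regular_graph_def)
  have sub: "set ?xs \<subseteq> verts G"
    using closed_trail_subgraph[OF assms(1) w] all by (simp add: subgraph_def)
  have len: "length ps = 2 * card (verts G)"
    using sum_count_set[OF sub fin(1)] count by simp
  obtain i j where ij: "i < j" "j < length ps" "fst (ps ! i) = fst (ps ! j)" "odd (j - i)"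
    using equal_entries_odd_distance[OF fin(1) assms(4) sub count]
    by (metis length_map less_trans nth_map)
  \<comment> \<open>\<open>B\<close> is the part of the tour between the two visits to
    \<open>x\<close>. The other closed trail is \<open>C @ A\<close>, which passes through the base
    point \<open>u\<close>; \<open>A\<close> is empty if \<open>i = 0\<close>.\<close>
  define x A B C where "x = fst (ps ! i)" and "A = take i ps"
    and "B = drop i (take j ps)" and "C = drop j ps"
  have "take j ps = A @ B"
    using ij unfolding A_def B_def by (metis append_take_drop_id less_imp_le_nat min.absorb1 take_take)
  then have ps: "ps = A @ B @ C"
    unfolding C_def by (metis append.assoc append_take_drop_id)
  have lenB: "length B = j - i" using ij by (simp add: B_def)
  have hdB: "B \<noteq> []" "fst (hd B) = x"
    using ij lenB by (auto simp: B_def x_def hd_drop_conv_nth)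
  have hdC: "C \<noteq> []" "fst (hd C) = x"
    using ij by (auto simp: C_def x_def hd_drop_conv_nth)
  obtain y z where yz: "walk (ends G) u A y" "walk (ends G) y B z" "walk (ends G) z C u"
    using w unfolding ps walk_append by auto
  \<comment> \<open>A nonempty walk starts at its first tail, so both junctions \<open>y\<close> and
    \<open>z\<close> equal \<open>x\<close>.\<close>
  then have wB: "walk (ends G) x B x" and wCA: "walk (ends G) x (C @ A) x"
    using walk_tail hdB hdC unfolding walk_append by metis+
  let ?H = "graph_of_walk (ends G) B" and ?K = "graph_of_walk (ends G) (C @ A)"
  have dist: "distinct (map snd B)" "distinct (map snd (C @ A))"
    and disj: "snd ` set B \<inter> snd ` set (C @ A) = {}"
    and un: "snd ` set B \<union> snd ` set (C @ A) = edges G"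
    using d all unfolding ps by auto
  have card: "card (snd ` set B) = length B" "card (snd ` set (C @ A)) = length (C @ A)"
    using distinct_card[OF dist(1)] distinct_card[OF dist(2)] by (simp_all add: image_Un)
  have oddB: "odd (length B)" using lenB ij by simp
  moreover have "length B + length (C @ A) = 2 * card (verts G)" using len ps by simp
  ultimately have oddCA: "odd (length (C @ A))" by (metis dvd_triv_left even_add)
  \<comment> \<open>The edge sets are disjoint and that of \<open>?H\<close> is nonempty. This
    yields both the injectivity of \<open>edges\<close> and the count of two constituents.\<close>
  have ne: "edges ?H \<noteq> edges ?K" using disj hdB(1) by auto
  then have "?H \<noteq> ?K" by metis
  have "odd_decomposition 2 G {?H, ?K}"
    unfolding odd_decomposition_def decomposition_def
  proof (intro conjI)
    show "\<forall>H\<in>{?H, ?K}. subgraph H G"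
      using closed_trail_subgraph[OF assms(1) wB] closed_trail_subgraph[OF assms(1) wCA] un by auto
    show "inj_on edges {?H, ?K}" using ne by auto
    show "partition_on (edges G) (edges ` {?H, ?K})"
      using un disj hdB hdC by (auto simp: partition_on_def disjoint_def)
    show "card {?H, ?K} = 2" using \<open>?H \<noteq> ?K\<close> by simp
    show "\<forall>H\<in>{?H, ?K}. eulerian H \<and> odd (card (edges H))"
      using closed_trail_eulerian[OF wB dist(1) hdB(1)] closed_trail_eulerian[OF wCA dist(2)]
        hdC(1) card oddB oddCA by simp
  qed simp
  moreover have "x \<in> verts ?H" "x \<in> verts ?K"
    using hdB hdC hd_in_set[OF hdB(1)] hd_in_set[OF hdC(1)]
    by (metis Un_iff graph_of_walk_simps(1) imageI set_append)+
  moreover have "x \<in> verts G" using sub ij by (simp add: x_def subset_iff)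
  ultimately show ?thesis
    unfolding rooted_def by (intro exI[of _ "{?H, ?K}"]) blast
qed

end
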